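(* Let $\lambda>0$ and $\mu>0$ be real with $\mu\notin\{1,2\}$, such that $\mathfrak{V}_n(x;\lambda;\mu)$ is defined. For every nonnegative integer $n$ and real $x$, $$\mathfrak{V}_{n+1}(x;\lambda;\mu)-x\,\mathfrak{V}_{n}(x;\lambda;\mu)=\frac{1}{2-\mu}\sum_{i=0}^{n}\binom{n}{i}(n-i)!\left(\frac{\mu}{2(\mu-2)}\right)^{n-i}\left[\frac{\mu}{2}\mathfrak{V}_{i}(x;\lambda;\mu)-\lambda\sum_{k=0}^{i}\binom{i}{k}\mathfrak{V}_{k}(\lambda;\mu)\,\mathfrak{V}_{i-k}(x+1;\lambda;\mu)\right].$$
   Context: For real $\lambda>0$ and real $\mu\ge0$ with $\mu\ne1$, the unified Bernoulli-Euler polynomials of Apostol type are defined by the Taylor expansion at $t=0$ $$\frac{2-\mu+\frac{\mu}{2}t}{\lambda e^{t}+(1-\mu)}e^{xt}=\sum_{n\ge0}\mathfrak{V}_n(x;\lambda;\mu)\frac{t^n}{n!}.$$ This requires the left side to be holomorphic at $t=0$, i.e. $\lambda+1-\mu\ne0$ or $(\lambda,\mu)=(1,2)$. The numbers are $\mathfrak{V}_n(\lambda;\mu):=\mathfrak{V}_n(0;\lambda;\mu)$. *)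

theory Defs
  imports "HOL-Analysis.Analysis"
begin

definition unified_BE_gf :: "real \<Rightarrow> real \<Rightarrow> real \<Rightarrow> complex \<Rightarrow> complex" where
  "unified_BE_gf x l m t =
     (of_real (2 - m) + of_real (m / 2) * t) / (of_real l * exp t + of_real (1 - m))
       * exp (of_real x * t)"

(* The filter at 0 is punctured: for l = 1, m = 2 the generating function has a removable
   singularity at 0, where division by zero gives 0 instead of the limit. If 0 is a pole, no
   such sequence a exists and the value is unspecified; unified_BE_poly_sums below shows
   existence and uniqueness for the admissible parameters. *)
definition unified_BE_poly :: "nat \<Rightarrow> real \<Rightarrow> real \<Rightarrow> real \<Rightarrow> real" where
  "unified_BE_poly n x l m =
     (THE a :: nat \<Rightarrow> real.
        \<forall>\<^sub>F t in at 0. (\<lambda>k. of_real (a k) * t ^ k / fact k) sums unified_BE_gf x l m t) n"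

definition unified_BE_num :: "nat \<Rightarrow> real \<Rightarrow> real \<Rightarrow> real" where
  "unified_BE_num n l m = unified_BE_poly n 0 l m"

lemma sums_at_0_unique:
  fixes a b :: "nat \<Rightarrow> complex"
  assumes a: "\<forall>\<^sub>F t in at 0. (\<lambda>k. a k * t ^ k / fact k) sums f t"
    and b: "\<forall>\<^sub>F t in at 0. (\<lambda>k. b k * t ^ k / fact k) sums f t"
  shows "a = b"
proof -
  define S where "S = (\<lambda>c::nat \<Rightarrow> complex. Abs_fps (\<lambda>k. c k / fact k))"
  have conv: "fps_conv_radius (S c) > 0" and
       ev: "\<forall>\<^sub>F t in at 0. eval_fps (S c) t = f t"
    if c: "\<forall>\<^sub>F t in at 0. (\<lambda>k. c k * t ^ k / fact k) sums f t" for c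
  proof -
    have c': "\<forall>\<^sub>F t in at 0. (\<lambda>k. fps_nth (S c) k * t ^ k) sums f t"
      using c by (simp add: S_def)
    show "\<forall>\<^sub>F t in at 0. eval_fps (S c) t = f t"
      using c' by eventually_elim (simp add: eval_fps_def sums_iff)
    have "\<forall>\<^sub>F t in at (0::complex). t \<noteq> 0"
      by (simp add: eventually_at_filter)
    with c' have "\<forall>\<^sub>F t in at 0. t \<noteq> 0 \<and> (\<lambda>k. fps_nth (S c) k * t ^ k) sums f t"
      by eventually_elim simp
    then obtain t :: complex where t: "t \<noteq> 0" "(\<lambda>k. fps_nth (S c) k * t ^ k) sums f t"
      using eventually_happens' [OF at_neq_bot] by blast
    from t(2) have "fps_conv_radius (S c) \<ge> norm t"
      unfolding fps_conv_radius_def by (intro conv_radius_geI) (rule sums_summable)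
    with t(1) show "fps_conv_radius (S c) > 0"
      by (metis ereal_less(2) less_le_trans zero_less_norm_iff)
  qed
  have "\<forall>\<^sub>F t in at 0. eval_fps (S a) t = eval_fps (S b) t"
    using ev[OF a] ev[OF b] by eventually_elim simp
  moreover have "eval_fps (S a) 0 = eval_fps (S b) 0"
  proof (rule LIM_unique)
    show "(eval_fps (S a) \<longlongrightarrow> eval_fps (S a) 0) (at 0)"
      using has_fps_expansion_imp_continuous[OF eval_fps_has_fps_expansion[OF conv[OF a]], of UNIV]
      by (simp add: continuous_within)
    have "(eval_fps (S b) \<longlongrightarrow> eval_fps (S b) 0) (at 0)"
      using has_fps_expansion_imp_continuous[OF eval_fps_has_fps_expansion[OF conv[OF b]], of UNIV]
      by (simp add: continuous_within)
    then show "(eval_fps (S a) \<longlongrightarrow> eval_fps (S b) 0) (at 0)"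
      using calculation by (simp add: tendsto_cong)
  qed
  ultimately have "\<forall>\<^sub>F t in nhds 0. eval_fps (S a) t = eval_fps (S b) t"
    by (simp add: eventually_nhds_conv_at)
  then have "S a = S b"
    by (intro eval_fps_eqD conv a b)
  then show "a = b"
    by (auto simp: S_def fps_eq_iff)
qed

lemma unified_BE_gf_fps_expansion:
  assumes "l + 1 - m \<noteq> 0 \<or> (l = 1 \<and> m = 2)"
  shows "\<exists>F. \<forall>\<^sub>F t in at 0. (\<lambda>k. fps_nth F k * t ^ k) sums unified_BE_gf x l m t"
proof -
  define N :: "complex fps" where
    "N = (fps_const (of_real (2 - m)) + fps_const (of_real (m / 2)) * fps_X) * fps_exp (of_real x)"
  define D :: "complex fps" where
    "D = fps_const (of_real l) * fps_exp 1 + fps_const (of_real (1 - m))"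
  define h where "h = (\<lambda>t::complex. (of_real (2 - m) + of_real (m / 2) * t) * exp (of_real x * t))"
  define d where "d = (\<lambda>t::complex. of_real l * exp t + of_real (1 - m))"
  have N: "h has_fps_expansion N" unfolding N_def h_def
    by (intro fps_expansion_intros)
  have D: "d has_fps_expansion D" unfolding D_def d_def
    by (intro fps_expansion_intros)
  have D0: "fps_nth D 0 = of_real (l + 1 - m)"
    by (simp add: D_def)
  have sub: "subdegree D \<le> subdegree N \<and> D \<noteq> 0"
  proof (cases "l + 1 - m = 0")
    case False
    then have "fps_nth D 0 \<noteq> 0" unfolding D0 by (metis of_real_eq_0_iff)
    then show ?thesis by (auto simp: subdegree_eq_0)
  next
    case True
    with assms have lm: "l = 1" "m = 2" by auto
    have D1: "fps_nth D 1 = 1" by (simp add: D_def lm)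
    then have "subdegree D \<le> 1" "D \<noteq> 0"
      by (auto intro: subdegree_leI)
    moreover have "N = fps_X * fps_exp (of_real x)" by (simp add: N_def lm)
    then have "subdegree N = 1" by simp
    ultimately show ?thesis by simp
  qed
  define c where "c = fps_nth N (subdegree D) / fps_nth D (subdegree D)"
  have E: "(\<lambda>t. if t = 0 then c else h t / d t) has_fps_expansion N / D"
    using sub by (intro has_fps_expansion_divide N D) (auto simp: c_def)
  have "\<forall>\<^sub>F t in nhds 0. t \<in> eball (0::complex) (fps_conv_radius (N / D))"
    using E by (intro eventually_nhds_in_open) (auto simp: has_fps_expansion_def zero_ereal_def)
  with E have "\<forall>\<^sub>F t in nhds 0. t \<in> eball 0 (fps_conv_radius (N / D)) \<and>
      eval_fps (N / D) t = (if t = 0 then c else h t / d t)"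
    by (simp add: has_fps_expansion_def eventually_conj_iff)
  then have "\<forall>\<^sub>F t in at 0. (\<lambda>k. fps_nth (N / D) k * t ^ k) sums unified_BE_gf x l m t"
    unfolding eventually_at_filter
  proof (eventually_elim, intro impI)
    fix t :: complex
    assume t: "t \<in> eball 0 (fps_conv_radius (N / D)) \<and>
        eval_fps (N / D) t = (if t = 0 then c else h t / d t)" and "t \<noteq> 0"
    then have "eval_fps (N / D) t = unified_BE_gf x l m t"
      by (simp add: unified_BE_gf_def h_def d_def)
    moreover have "(\<lambda>k. fps_nth (N / D) k * t ^ k) sums eval_fps (N / D) t"
      using t by (intro sums_eval_fps) (simp add: in_eball_iff)
    ultimately show "(\<lambda>k. fps_nth (N / D) k * t ^ k) sums unified_BE_gf x l m t"
      by simp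
  qed
  then show ?thesis by blast
qed

lemma unified_BE_poly_ex1:
  assumes "l + 1 - m \<noteq> 0 \<or> (l = 1 \<and> m = 2)"
  shows "\<exists>!a :: nat \<Rightarrow> real.
           \<forall>\<^sub>F t in at 0. (\<lambda>k. of_real (a k) * t ^ k / fact k) sums unified_BE_gf x l m t"
proof -
  let ?G = "unified_BE_gf x l m"
  obtain F where F: "\<forall>\<^sub>F t in at 0. (\<lambda>k. fps_nth F k * t ^ k) sums ?G t"
    using unified_BE_gf_fps_expansion[OF assms] by blast
  define b where "b = (\<lambda>k. fps_nth F k * fact k)"
  have b: "\<forall>\<^sub>F t in at 0. (\<lambda>k. b k * t ^ k / fact k) sums ?G t"
    using F by (simp add: b_def)
  have "filterlim cnj (at 0) (at 0)"
    unfolding filterlim_at by (auto simp: eventually_at_filter intro!: tendsto_eq_intros)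
  from eventually_compose_filterlim[OF b this]
  have "\<forall>\<^sub>F t in at 0. (\<lambda>k. cnj (b k) * t ^ k / fact k) sums ?G t"
  proof eventually_elim
    case (elim t)
    then have "(\<lambda>k. cnj (b k * cnj t ^ k / fact k)) sums cnj (?G (cnj t))"
      by (simp only: sums_cnj)
    then show ?case by (simp add: unified_BE_gf_def exp_cnj)
  qed
  from sums_at_0_unique[OF this b] have "cnj (b k) = b k" for k
    by metis
  then have "of_real (Re (b k)) = b k" for k
    by (metis Reals_cnj_iff of_real_Re)
  then have "\<forall>\<^sub>F t in at 0. (\<lambda>k. of_real (Re (b k)) * t ^ k / fact k) sums ?G t"
    using b by simp
  then show ?thesis
  proof (rule ex1I[where a = "\<lambda>k. Re (b k)"])
    fix a :: "nat \<Rightarrow> real"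
    assume a: "\<forall>\<^sub>F t in at 0. (\<lambda>k. of_real (a k) * t ^ k / fact k) sums ?G t"
    show "a = (\<lambda>k. Re (b k))"
      using sums_at_0_unique[OF a b] by auto
  qed
qed

lemma unified_BE_poly_sums:
  assumes "l + 1 - m \<noteq> 0 \<or> (l = 1 \<and> m = 2)"
  shows "\<forall>\<^sub>F t in at 0.
           (\<lambda>n. of_real (unified_BE_poly n x l m) * t ^ n / fact n) sums unified_BE_gf x l m t"
  unfolding unified_BE_poly_def by (rule theI'[OF unified_BE_poly_ex1[OF assms]])

end

theory Submission
  imports Defs
begin

text \<open>Write \<open>N(t) = 2 - m + m t / 2\<close>, \<open>D(t) = l e\<^sup>t + 1 - m\<close> and
  \<open>G\<^sub>x = N e\<^sup>x\<^sup>t / D\<close>. Since \<open>D' = l e\<^sup>t\<close>, differentiating gives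
  \<open>N (G\<^sub>x' - x G\<^sub>x) = (m / 2) G\<^sub>x - l G\<^sub>0 G\<^bsub>x+1\<^esub>\<close>.
  Dividing by \<open>N\<close>, whose reciprocal is a geometric series because \<open>m \<noteq> 2\<close>,
  and comparing coefficients yields the recurrence.\<close>

text \<open>The inverse is the geometric series with ratio \<open>- b / a\<close>: multiplied by the
  linear series, its neighbouring terms cancel in every coefficient of positive index.\<close>

lemma inverse_linear_fps_nth:
  fixes a b :: "'a :: field"
  assumes "a \<noteq> 0"
  shows "fps_nth (inverse (fps_const a + fps_const b * fps_X)) n = (- b / a) ^ n / a"
proof -
  define P where "P = fps_const a + fps_const b * fps_X"
  define Q where "Q = Abs_fps (\<lambda>n. (- b / a) ^ n / a)"
  have "Q * P = 1"
  proof (rule fps_ext)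
    show "fps_nth (Q * P) k = fps_nth 1 k" for k
      using assms
      by (cases k) (simp_all add: P_def Q_def algebra_simps fps_mult_fps_X_commute[symmetric])
  qed
  then have "Q = inverse P"
    by (metis fps_inverse_unique mult.commute)
  then show ?thesis
    by (metis P_def Q_def fps_nth_Abs_fps)
qed

text \<open>With the division by \<open>fact n\<close>, binomial convolutions become plain products.
  The coefficients are complex because \<open>unified_BE_gf\<close> is a function of a complex
  variable.\<close>

definition unified_BE_fps :: "real \<Rightarrow> real \<Rightarrow> real \<Rightarrow> complex fps" where
  "unified_BE_fps x l m = Abs_fps (\<lambda>n. of_real (unified_BE_poly n x l m) / fact n)"

text \<open>Passes from the analytic definition to formal series: the right side converges to
  \<open>unified_BE_gf\<close> near 0, and Taylor coefficients are unique. The assumption says that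
  the denominator has a nonzero constant term, hence a formal inverse.\<close>

lemma unified_BE_fps_eq:
  assumes "l + 1 - m \<noteq> 0"
  shows "unified_BE_fps x l m =
    (fps_const (of_real (2 - m)) + fps_const (of_real (m / 2)) * fps_X) *
      inverse (fps_const (of_real l) * fps_exp 1 + fps_const (of_real (1 - m))) *
      fps_exp (of_real x)" (is "_ = ?H")
proof -
  have nz: "complex_of_real l + of_real (1 - m) \<noteq> 0"
    using assms by (metis add_diff_eq of_real_add of_real_eq_0_iff)
  have "(\<lambda>t. (of_real (2 - m) + of_real (m / 2) * t) *
          inverse (of_real l * exp (1 * t) + of_real (1 - m)) * exp (of_real x * t))
        has_fps_expansion ?H"
    using nz by (intro fps_expansion_intros) simp_all
  then have E: "unified_BE_gf x l m has_fps_expansion ?H"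
    by (simp only: unified_BE_gf_def[abs_def] divide_inverse mult_1_left)
  have "\<forall>\<^sub>F t in nhds 0. t \<in> eball (0::complex) (fps_conv_radius ?H)"
    using E by (intro eventually_nhds_in_open) (auto simp: has_fps_expansion_def zero_ereal_def)
  moreover have "\<forall>\<^sub>F t in nhds 0. eval_fps ?H t = unified_BE_gf x l m t"
    using E by (simp add: has_fps_expansion_def)
  ultimately have "\<forall>\<^sub>F t in nhds 0. (\<lambda>k. fps_nth ?H k * t ^ k) sums unified_BE_gf x l m t"
  proof eventually_elim
    case (elim t)
    then have "(\<lambda>k. fps_nth ?H k * t ^ k) sums eval_fps ?H t"
      by (intro sums_eval_fps) (simp add: in_eball_iff)
    with elim show ?case by simp
  qed
  \<comment> \<open>The factor \<open>fact k\<close> is inserted to match the normalisation in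
    \<open>sums_at_0_unique\<close>.\<close>
  then have "\<forall>\<^sub>F t in at 0. (\<lambda>k. (fps_nth ?H k * fact k) * t ^ k / fact k) sums unified_BE_gf x l m t"
    by (simp add: eventually_nhds_conv_at)
  moreover have "\<forall>\<^sub>F t in at 0.
      (\<lambda>k. of_real (unified_BE_poly k x l m) * t ^ k / fact k) sums unified_BE_gf x l m t"
    by (rule unified_BE_poly_sums) (use assms in simp)
  ultimately have "(\<lambda>k. fps_nth ?H k * fact k) = (\<lambda>k. of_real (unified_BE_poly k x l m))"
    by (rule sums_at_0_unique)
  then have "fps_nth ?H k * fact k = of_real (unified_BE_poly k x l m)" for k
    by meson
  then show ?thesis
    unfolding unified_BE_fps_def by (intro fps_ext) (simp add: field_simps)
qed

lemma unified_BE_fps_deriv: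
  assumes "l + 1 - m \<noteq> 0"
  shows "(fps_const (of_real (2 - m)) + fps_const (of_real (m / 2)) * fps_X) *
      (fps_deriv (unified_BE_fps x l m) - fps_const (of_real x) * unified_BE_fps x l m) =
    fps_const (of_real (m / 2)) * unified_BE_fps x l m -
      fps_const (of_real l) * (unified_BE_fps 0 l m * unified_BE_fps (x + 1) l m)"
proof -
  define N :: "complex fps" where
    "N = fps_const (of_real (2 - m)) + fps_const (of_real (m / 2)) * fps_X"
  define D :: "complex fps" where
    "D = fps_const (of_real l) * fps_exp 1 + fps_const (of_real (1 - m))"
  have "complex_of_real l + of_real (1 - m) \<noteq> 0"
    using assms by (metis add_diff_eq of_real_add of_real_eq_0_iff)
  then have "fps_nth D 0 \<noteq> 0" by (simp add: D_def)
  then have I: "fps_deriv (inverse D) = - fps_deriv D * (inverse D)\<^sup>2"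
    by (rule fps_inverse_deriv)
  have dD: "fps_deriv D = fps_const (of_real l) * fps_exp 1"
    by (simp add: D_def)
  have dN: "fps_deriv N = fps_const (of_real (m / 2))"
    by (simp add: N_def)
  have G: "unified_BE_fps y l m = N * inverse D * fps_exp (of_real y)" for y
    unfolding N_def D_def by (rule unified_BE_fps_eq[OF assms])
  \<comment> \<open>The factor \<open>fps_exp 1\<close> left by \<open>fps_deriv D\<close> shifts
    \<open>x\<close> to \<open>x + 1\<close>; the two factors \<open>N * inverse D\<close> of the
    quadratic term are shared between the series at \<open>0\<close> and at
    \<open>x + 1\<close>.\<close>
  have "fps_exp (complex_of_real (x + 1)) = fps_exp (of_real x) * fps_exp 1"
    by (simp add: fps_exp_add_mult)
  then show ?thesis
    unfolding N_def[symmetric] G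
    by (simp add: I dD dN algebra_simps power2_eq_square)
qed

theorem theorem8:
  fixes l m x :: real and n :: nat
  assumes "l > 0" and "m > 0" and "m \<noteq> 1" and "m \<noteq> 2"
    and "l + 1 - m \<noteq> 0 \<or> (l = 1 \<and> m = 2)"
  shows "unified_BE_poly (n + 1) x l m - x * unified_BE_poly n x l m =
    1 / (2 - m) *
      (\<Sum>i=0..n. real (n choose i) * fact (n - i) * (m / (2 * (m - 2))) ^ (n - i) *
         (m / 2 * unified_BE_poly i x l m -
          l * (\<Sum>k=0..i. real (i choose k) * unified_BE_num k l m
                            * unified_BE_poly (i - k) (x + 1) l m)))"
proof -
  define N :: "complex fps" where
    "N = fps_const (of_real (2 - m)) + fps_const (of_real (m / 2)) * fps_X"
  define V where "V = (\<lambda>y k. unified_BE_poly k y l m)"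
  define B where "B = (\<lambda>i. m / 2 * V x i - l * (\<Sum>k=0..i. real (i choose k) * V 0 k * V (x + 1) (i - k)))"
  define R where "R = fps_const (of_real (m / 2)) * unified_BE_fps x l m -
      fps_const (of_real l) * (unified_BE_fps 0 l m * unified_BE_fps (x + 1) l m)"
  define r where "r = m / (2 * (m - 2))"
  let ?L = "fps_deriv (unified_BE_fps x l m) - fps_const (of_real x) * unified_BE_fps x l m"
  have lm: "l + 1 - m \<noteq> 0" using assms by auto
  have m2: "complex_of_real (2 - m) \<noteq> 0"
    using assms by (metis eq_iff_diff_eq_0 of_real_eq_0_iff)
  have "fps_nth N 0 \<noteq> 0" using m2 by (simp add: N_def)
  then have "inverse N * N = 1" by (rule inverse_mult_eq_1)
  moreover have "N * ?L = R"
    unfolding N_def R_def by (rule unified_BE_fps_deriv[OF lm])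
  ultimately have L: "?L = R * inverse N"
    by (metis mult.assoc mult.commute mult_1)
  \<comment> \<open>The Cauchy product of two exponential generating functions is the binomial
    convolution in \<open>B\<close>, up to \<open>fact i\<close>.\<close>
  have R: "fps_nth R i = of_real (B i / fact i)" for i
  proof -
    have "(\<Sum>k=0..i. real (i choose k) * V 0 k * V (x + 1) (i - k)) / fact i =
        (\<Sum>k=0..i. V 0 k / fact k * (V (x + 1) (i - k) / fact (i - k)))"
      unfolding sum_divide_distrib
      by (rule sum.cong) (simp_all add: binomial_fact field_simps)
    then have "B i / fact i = m / 2 * (V x i / fact i) -
        l * (\<Sum>k=0..i. V 0 k / fact k * (V (x + 1) (i - k) / fact (i - k)))"
      unfolding B_def by (simp add: diff_divide_distrib flip: times_divide_eq_right)
    moreover have "fps_nth (unified_BE_fps 0 l m * unified_BE_fps (x + 1) l m) i =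
        of_real (\<Sum>k=0..i. V 0 k / fact k * (V (x + 1) (i - k) / fact (i - k)))"
      by (simp add: unified_BE_fps_def V_def fps_mult_nth)
    ultimately show ?thesis
      by (simp add: R_def) (simp add: unified_BE_fps_def V_def)
  qed
  have rr: "- complex_of_real (m / 2) / of_real (2 - m) = of_real r"
  proof -
    have "- (m / 2) / (2 - m) = r" using assms by (simp add: r_def field_simps)
    then show ?thesis by (metis of_real_divide of_real_minus)
  qed
  have Ninv: "fps_nth (inverse N) j = of_real (r ^ j / (2 - m))" for j
    unfolding N_def inverse_linear_fps_nth[OF m2] rr by simp
  \<comment> \<open>Differentiation brings down \<open>n + 1\<close>, which reduces
    \<open>fact (n + 1)\<close> to \<open>fact n\<close>.\<close>
  have "complex_of_real ((V x (n + 1) - x * V x n) / fact n) = fps_nth ?L n"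
    by (simp add: unified_BE_fps_def V_def fact_Suc diff_divide_distrib del: of_nat_Suc)
  also have "\<dots> = of_real (\<Sum>i=0..n. B i / fact i * (r ^ (n - i) / (2 - m)))"
    unfolding L fps_mult_nth R Ninv by simp
  finally have "(V x (n + 1) - x * V x n) / fact n =
      (\<Sum>i=0..n. B i / fact i * (r ^ (n - i) / (2 - m)))"
    by (rule of_real_eq_iff[THEN iffD1])
  then have "V x (n + 1) - x * V x n =
      fact n * (\<Sum>i=0..n. B i / fact i * (r ^ (n - i) / (2 - m)))"
    by (simp add: field_simps)
  \<comment> \<open>Here \<open>fact n / fact i\<close> is rewritten as
    \<open>(n choose i) * fact (n - i)\<close>.\<close>
  also have "\<dots> = 1 / (2 - m) * (\<Sum>i=0..n. real (n choose i) * fact (n - i) * r ^ (n - i) * B i)"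
    unfolding sum_distrib_left
    by (rule sum.cong) (simp_all add: binomial_fact mult_ac)
  finally show ?thesis
    unfolding V_def B_def r_def unified_BE_num_def .
qed

end
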